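(* Let $G$ be an elementary abelian $2$-group of order $n=2^r$, and let $h$ be an integer with $n/2-1\le h\le n-2$. Then $C_h(G)=Z_h(G)=h+2$, except when $h=n-4$, in which case $C_h(G)=h+2$ and $Z_h(G)=h$.
   Context: $G$ is written additively. For a subset $A\subseteq G$ and positive integer $h$, the $h$-fold restricted sumset $h\hat{\;}A$ is the set of all elements of $G$ that can be written as a sum of $h$ pairwise distinct elements of $A$. Define $C_h(G)=\max\{|A| : A\subseteq G,\ h\hat{\;}A\neq G\}$ and $Z_h(G)=\max\{|A| : A\subseteq G,\ 0\notin h\hat{\;}A\}$. *)

theory Defs
  imports Complex_Main "HOL-Library.Cardinality"
begin

text \<open>
  A finite abelian group is a type of class \<open>ab_group_add\<close> and \<open>finite\<close>; quantities attached to
  the group as a whole take it as an argument of type \<open>'a itself\<close>.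
\<close>

definition elementary_abelian_2_group :: "'a::ab_group_add itself \<Rightarrow> bool" where
  "elementary_abelian_2_group _ \<longleftrightarrow> (\<forall>x::'a. x + x = 0)"

text \<open>A sum of \<open>h\<close> pairwise distinct elements of \<open>A\<close> is the sum over an \<open>h\<close>-element subset of \<open>A\<close>.\<close>

definition restricted_sumset :: "nat \<Rightarrow> 'a::ab_group_add set \<Rightarrow> 'a set" where
  "restricted_sumset h A = {\<Sum>S | S. S \<subseteq> A \<and> finite S \<and> card S = h}"

text \<open>
  Both maxima range over a finite set of cardinalities, nonempty for \<open>h > 0\<close> because
  \<open>A = {}\<close> then qualifies. For \<open>h = 0\<close> the value \<open>Z_num\<close> is an unspecified \<open>Max {}\<close>.
\<close>

definition C_num :: "'a::{ab_group_add,finite} itself \<Rightarrow> nat \<Rightarrow> nat" where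
  "C_num _ h = Max {card A | A :: 'a set. restricted_sumset h A \<noteq> UNIV}"

definition Z_num :: "'a::{ab_group_add,finite} itself \<Rightarrow> nat \<Rightarrow> nat" where
  "Z_num _ h = Max {card A | A :: 'a set. 0 \<notin> restricted_sumset h A}"

end

(* For a set A with h + j elements, the h-fold restricted sums are the differences of the total
   of A and a j-fold restricted sum.
   For j = 2 the total itself is missed, because two distinct elements never cancel; so
   C_h >= h + 2, and Z_h >= h + 2 as soon as some (h + 2)-set has total 0. For j = 3 the three
   distinct summands of a given g exist as soon as |A| >= n/2 + 2, since A then meets each of its
   translates in at least 4 points; so both invariants are at most h + 2.
   If h = n - 4, a set of size h + 1 has total x + y + z where {x, y, z} is its complement; this
   total lies in A, so removing it leaves h elements with sum 0, and Z_h drops to h. *)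
theory Submission
  imports Defs
begin

section \<open>Maxima of cardinalities and general facts on restricted sumsets\<close>

lemma Max_card_eqI:
  fixes P :: "'a::finite set \<Rightarrow> bool"
  assumes "P A" "card A = k" and "\<And>B. P B \<Longrightarrow> card B \<le> k"
  shows "Max {card A | A. P A} = k"
proof (rule Max_eqI)
  have "{card A | A. P A} = card ` {A. P A}" by blast
  then show "finite {card A | A. P A}" by simp
qed (use assms in blast)+

lemma card_Compl_finite: "card (- A) = CARD('a) - card (A :: 'a::finite set)"
  unfolding Compl_eq_Diff_UNIV by (rule card_Diff_subset) simp_all

lemma restricted_sumset_mono:
  "A \<subseteq> B \<Longrightarrow> restricted_sumset h A \<subseteq> restricted_sumset h B"
  unfolding restricted_sumset_def by blast

lemma restricted_sumset_complement:
  fixes A :: "'a::{ab_group_add,finite} set"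
  assumes "card A = h + j"
  shows "restricted_sumset h A = (\<lambda>x. \<Sum>A - x) ` restricted_sumset j A"
proof (intro equalityI subsetI)
  fix g assume "g \<in> restricted_sumset h A"
  then obtain S where S: "S \<subseteq> A" "card S = h" "g = \<Sum>S"
    unfolding restricted_sumset_def by blast
  then have "\<Sum>(A - S) = \<Sum>A - g" "card (A - S) = j"
    using assms by (simp_all add: sum_diff card_Diff_subset)
  then have "\<Sum>A - g \<in> restricted_sumset j A"
    unfolding restricted_sumset_def by (intro CollectI exI[of _ "A - S"]) auto
  then show "g \<in> (\<lambda>x. \<Sum>A - x) ` restricted_sumset j A"
    by (intro image_eqI[of _ _ "\<Sum>A - g"]) auto
next
  fix g assume "g \<in> (\<lambda>x. \<Sum>A - x) ` restricted_sumset j A"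
  then obtain T where T: "T \<subseteq> A" "card T = j" "g = \<Sum>A - \<Sum>T"
    unfolding restricted_sumset_def by blast
  then have "\<Sum>(A - T) = g" "card (A - T) = h"
    using assms by (simp_all add: sum_diff card_Diff_subset)
  then show "g \<in> restricted_sumset h A"
    unfolding restricted_sumset_def by (intro CollectI exI[of _ "A - T"]) auto
qed

lemma restricted_sumset_one:
  "restricted_sumset 1 A = A"
proof -
  have "x \<in> restricted_sumset 1 A" if "x \<in> A" for x
    unfolding restricted_sumset_def using that by (intro CollectI exI[of _ "{x}"]) auto
  then show ?thesis
    unfolding restricted_sumset_def by (auto simp: card_1_singleton_iff)
qed

lemma restricted_sumset_card:
  fixes A :: "'a::{ab_group_add,finite} set"
  shows "restricted_sumset (card A) A = {\<Sum>A}"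
  unfolding restricted_sumset_def by (auto intro: card_subset_eq dest: card_subset_eq[rotated])

section \<open>Cancellation and twofold sums in characteristic two\<close>

context
  assumes char2: "\<And>x::'a::{ab_group_add,finite}. x + x = 0"
begin

lemma add_eq_zero_iff: "(x::'a) + y = 0 \<longleftrightarrow> x = y"
  using char2 by (metis add_left_cancel)

lemma uminus_char2: "- (x::'a) = x"
  using char2 minus_unique by blast

lemma diff_char2: "(x::'a) - y = x + y"
  by (metis diff_conv_add_uminus uminus_char2)

lemma add_cancel_char2: "(x::'a) + (x + y) = y"
  by (simp add: add.assoc[symmetric] char2)

lemma zero_notin_restricted_sumset_two: "(0::'a) \<notin> restricted_sumset 2 A"
proof
  assume "0 \<in> restricted_sumset 2 A"
  then obtain x y where "x \<noteq> y" "\<Sum>{x, y} = (0::'a)"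
    unfolding restricted_sumset_def card_2_iff by force
  then show False by (simp add: add_eq_zero_iff)
qed

lemma sum_notin_restricted_sumset:
  fixes A :: "'a set"
  assumes "card A = h + 2"
  shows "\<Sum>A \<notin> restricted_sumset h A"
  using zero_notin_restricted_sumset_two[of A]
  by (auto simp: restricted_sumset_complement[OF assms])

section \<open>Threefold sums and the upper bound\<close>

lemma restricted_sumset_three:
  fixes A :: "'a set"
  assumes "CARD('a) + 4 \<le> 2 * card A"
  shows "restricted_sumset 3 A = UNIV"
proof -
  have "g \<in> restricted_sumset 3 A" for g
  proof -
    have "card A \<le> CARD('a)" by (simp add: card_mono)
    then have "1 < card A" using assms by linarith
    then obtain c where c: "c \<in> A" "c \<noteq> g"
      by (metis One_nat_def card_le_Suc0_iff_eq finite leD)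
    \<comment> \<open>A point a of \<open>A\<close> in this translate yields b in \<open>A\<close>
      with a + b + c = g. Here a = b is excluded by c \<noteq> g, and b = c would mean a = g. So
      only the values c and g of a must be avoided, and the overlap has at least 4 points.\<close>
    define B where "B = (\<lambda>x. x + (g + c)) ` A"
    have "card B = card A" unfolding B_def by (simp add: card_image)
    moreover have "card (A \<union> B) \<le> CARD('a)" by (simp add: card_mono)
    moreover have "card A + card B = card (A \<union> B) + card (A \<inter> B)" by (rule card_Un_Int) auto
    ultimately have "card {c, g} < card (A \<inter> B)"
      using assms card_length[of "[c, g]"] by simp
    then obtain a where a: "a \<in> A" "a \<in> B" "a \<noteq> c" "a \<noteq> g"
      by (metis IntE card_mono finite insertCI leD subsetI)
    then obtain b where b: "b \<in> A" "a = b + (g + c)" unfolding B_def by blast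
    have ab: "a \<noteq> b" using b(2) c(2) by (auto simp: add_eq_zero_iff)
    have bc: "b \<noteq> c" using b(2) a(4) by (metis add.commute add_cancel_char2)
    have "a + (b + c) = g"
      unfolding b(2) by (metis add.assoc add.commute add_cancel_char2)
    then have "\<Sum>{a, b, c} = g" "card {a, b, c} = 3" using ab bc a(3) by auto
    then show ?thesis
      unfolding restricted_sumset_def using a(1) b(1) c(1)
      by (intro CollectI exI[of _ "{a, b, c}"]) auto
  qed
  then show ?thesis by blast
qed

lemma card_le_if_restricted_sumset_neq_UNIV:
  fixes A :: "'a set"
  assumes "restricted_sumset h A \<noteq> UNIV" "CARD('a) \<le> 2 * h + 2"
  shows "card A \<le> h + 2"
proof (rule ccontr)
  assume "\<not> card A \<le> h + 2"
  then have "h + 3 \<le> card A" by simp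
  \<comment> \<open>With exactly h + 3 elements, complementation applies with j = 3, and 2(h + 3)
    \<ge> \<open>CARD('a)\<close> + 4.\<close>
  then obtain B where B: "B \<subseteq> A" "card B = h + 3" by (metis obtain_subset_with_card_n)
  then have "restricted_sumset 3 B = UNIV" using assms by (intro restricted_sumset_three) simp
  then have "restricted_sumset h B = UNIV"
    unfolding restricted_sumset_complement[OF B(2)] by (simp add: surj_diff_right)
  with restricted_sumset_mono[OF B(1)] assms(1) show False by blast
qed

section \<open>Which totals a set of given size can have\<close>

lemma sum_translation_invariant:
  fixes A :: "'a set"
  assumes "t \<noteq> 0" "\<And>x. x \<in> A \<Longrightarrow> x + t \<in> A"
  shows "\<Sum>A \<in> {0, t}"
  using assms(2)
proof (induction "card A" arbitrary: A rule: less_induct)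
  case less
  show ?case
  proof (cases "A = {}")
    case False
    then obtain a where a: "a \<in> A" by blast
    \<comment> \<open>\<open>A\<close> splits into pairs {a, a + t}, each contributing t to the
      total; the induction removes one pair.\<close>
    define B where "B = A - {a, a + t}"
    have at: "a + t \<in> A" "a \<noteq> a + t" using a less(2) assms(1) by auto
    have "card B < card A" unfolding B_def using a by (intro psubset_card_mono) auto
    \<comment> \<open>Translation by t is an involution, so it moves no outside point into the
      pair.\<close>
    moreover have "x + t \<in> B" if "x \<in> B" for x
      using that less(2)[of x] unfolding B_def
      by (auto simp: add.assoc char2 dest: arg_cong[of _ _ "\<lambda>y. y + t"])
    ultimately have IH: "\<Sum>B \<in> {0, t}" by (rule less(1))
    have "A = insert a (insert (a + t) B)" using a at unfolding B_def by auto
    then have "\<Sum>A = a + (a + t + \<Sum>B)"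
      using at by (metis B_def Diff_iff finite insertCI insertE sum.insert)
    then have "\<Sum>A = t + \<Sum>B" by (simp add: add.assoc add_cancel_char2)
    then show ?thesis using IH by (auto simp: char2)
  qed simp
qed

text \<open>The group is invariant under every translation, so its total lies in both {0, s} and {0,
  t} for distinct nonzero s and t.\<close>

lemma sum_UNIV_char2:
  assumes "3 \<le> CARD('a)"
  shows "\<Sum>(UNIV :: 'a set) = 0"
proof -
  have missed: "\<exists>t. t \<notin> S" if "card S < 3" for S :: "'a set"
    using that assms by (metis UNIV_eq_I not_le)
  obtain s :: 'a where s: "s \<notin> {0}" using missed[of "{0}"] by auto
  have "card {0, s} < 3" using card_length[of "[0, s]"] by simp
  then obtain t where "t \<notin> {0, s}" using missed by blast
  then show ?thesis
    using s sum_translation_invariant[of s UNIV] sum_translation_invariant[of t UNIV] by auto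
qed

lemma sum_Compl_char2:
  assumes "3 \<le> CARD('a)"
  shows "\<Sum>(- A) = \<Sum>(A :: 'a set)"
proof -
  have "\<Sum>(- A) = \<Sum>UNIV - \<Sum>A"
    unfolding Compl_eq_Diff_UNIV by (rule sum_diff) simp_all
  then show ?thesis by (simp only: sum_UNIV_char2[OF assms] diff_0 uminus_char2)
qed

lemma sum_swap:
  fixes A :: "'a set"
  assumes "x \<in> A" "y \<notin> A"
  shows "\<Sum>(insert y (A - {x})) = \<Sum>A + x + y" "card (insert y (A - {x})) = card A"
proof -
  have "\<Sum>A = x + \<Sum>(A - {x})" using assms(1) by (simp add: sum.remove)
  then have "\<Sum>A + x = \<Sum>(A - {x})" by (metis add.commute add_cancel_char2)
  then show "\<Sum>(insert y (A - {x})) = \<Sum>A + x + y" using assms(2) by (simp add: add.commute)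
  show "card (insert y (A - {x})) = card A"
    using assms
    by (subst card_insert_disjoint) (simp_all only: card_Suc_Diff1 finite Diff_iff simp_thms)
qed

text \<open>Exchanging an element for an outside one changes the total, so two m-sets have different
  totals and one of these is nonzero.\<close>

lemma ex_nonzero_sum:
  assumes "0 < m" "m < CARD('a)"
  shows "\<exists>A::'a set. card A = m \<and> \<Sum>A \<noteq> 0"
proof -
  obtain A :: "'a set" where A: "card A = m"
    using assms(2) by (metis obtain_subset_with_card_n less_imp_le)
  obtain x y where xy: "x \<in> A" "y \<notin> A"
    using A assms by (metis card.empty ex_in_conv UNIV_eq_I less_irrefl)
  then have "x + y \<noteq> 0" by (auto simp: add_eq_zero_iff)
  then have "\<Sum>(insert y (A - {x})) \<noteq> \<Sum>A" using sum_swap(1)[OF xy] by (simp add: add.assoc)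
  then show ?thesis using A sum_swap(2)[OF xy] by metis
qed

text \<open>If no \<open>m\<close>-set has sum \<open>0\<close>, then no exchange of one element can cancel the sum, which means
  that every \<open>m\<close>-set is invariant under translation by its own sum. Applying this to a set \<open>A\<close> and
  to its one-element exchanges shows that \<open>u + v + y \<in> A\<close> for generic \<open>u, v \<in> A\<close> and \<open>y \<notin> A\<close>,
  and three such steps carry an element outside \<open>A\<close> into \<open>A\<close>.\<close>

lemma ex_zero_sum:
  assumes "3 \<le> m" "m + 3 \<le> CARD('a)"
  shows "\<exists>A::'a set. card A = m \<and> \<Sum>A = 0"
proof (rule ccontr)
  assume none: "\<nexists>A::'a set. card A = m \<and> \<Sum>A = 0"
  \<comment> \<open>Otherwise exchanging x for x + \<Sum>A would add \<Sum>A to the total and cancel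
    it.\<close>
  have invariant: "x + \<Sum>A \<in> A" if "card A = m" "x \<in> A" for x and A :: "'a set"
  proof (rule ccontr)
    assume "x + \<Sum>A \<notin> A"
    from sum_swap[OF that(2) this] that(1) none char2 show False
      by (metis add.assoc add.commute)
  qed
  obtain A :: "'a set" where A: "card A = m"
    using assms(2) by (metis obtain_subset_with_card_n add_leD1)
  define s where "s = \<Sum>A"
  have inv: "x + s \<in> A" if "x \<in> A" for x using invariant[OF A that] by (simp add: s_def)
  \<comment> \<open>The exchanged set has total s + v + y, so it contains u + s + v + y. As u
    \<noteq> v + s, this is not the new element y; hence it lies in \<open>A\<close>, and
    translation by s removes the s.\<close>
  have step: "u + v + y \<in> A" if "u \<in> A" "v \<in> A" "u \<noteq> v" "u \<noteq> v + s" "y \<notin> A" for u v y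
  proof -
    define A' where "A' = insert y (A - {v})"
    have A': "\<Sum>A' = s + v + y" "card A' = m"
      unfolding A'_def using sum_swap[OF that(2,5)] A by (simp_all add: s_def)
    have "u \<in> A'" using that unfolding A'_def by blast
    then have "u + (s + v + y) \<in> A'" using invariant[OF A'(2)] A'(1) by simp
    moreover have "u + (s + v + y) \<noteq> y"
    proof
      assume "u + (s + v + y) = y"
      then have "u + (v + s) = 0" by (simp add: algebra_simps)
      with that(4) show False by (simp add: add_eq_zero_iff)
    qed
    ultimately have "u + (s + v + y) + s \<in> A" unfolding A'_def using inv by blast
    moreover have "u + (s + v + y) + s = u + v + y"
      using add_cancel_char2[of s "u + v + y"] by (simp add: algebra_simps)
    ultimately show ?thesis by simp
  qed
  \<comment> \<open>This supplies the generic elements; the two bounds on m make it applicable to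
    \<open>A\<close> and to its complement.\<close>
  have third: "\<exists>z\<in>S. z \<noteq> w \<and> z \<noteq> w + s" if "3 \<le> card S" for S and w :: 'a
  proof (rule ccontr)
    assume "\<not> (\<exists>z\<in>S. z \<noteq> w \<and> z \<noteq> w + s)"
    then have "card S \<le> card {w, w + s}" by (intro card_mono) auto
    then show False using that card_length[of "[w, w + s]"] by simp
  qed
  have "card (- A) = CARD('a) - m" using A by (simp add: card_Compl_finite)
  then have cA: "3 \<le> card (- A)" using assms by simp
  obtain x where x: "x \<in> A" using A assms third[of A 0] by auto
  obtain x' where x': "x' \<in> A" "x' \<noteq> x" "x' \<noteq> x + s" using A assms third[of A x] by auto
  obtain y where y: "y \<notin> A" using third[OF cA] by auto
  obtain y' where y': "y' \<notin> A" "y' \<noteq> y" "y' \<noteq> y + s" using third[OF cA, of y] by auto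
  have xy: "x \<noteq> y" "x + s \<noteq> y" using x y inv by auto
  \<comment> \<open>Three uses of \<open>step\<close> put x' + x + y, then x + y + y', and finally
    y' into \<open>A\<close>, although y' was chosen outside.\<close>
  have 1: "x' + x + y \<in> A" using step x x' y by blast
  have "x' + x + y \<noteq> x'" "x' + x + y \<noteq> x' + s"
    using xy add_eq_zero_iff[of x y] add_cancel_char2[of x y] by (auto simp: add.assoc)
  then have "x' + x + y + x' + y' \<in> A" using step[OF 1 x'(1)] y'(1) by blast
  moreover have "x' + x + y + x' + y' = x + y + y'"
    using add_cancel_char2[of x' "x + y + y'"] by (simp add: algebra_simps)
  ultimately have 2: "x + y + y' \<in> A" by simp
  have "x + y + y' \<noteq> x" "x + y + y' \<noteq> x + s"
    using y' add_eq_zero_iff[of y y'] add_cancel_char2[of y y'] by (auto simp: add.assoc)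
  then have "x + y + y' + x + y \<in> A" using step[OF 2 x] y by blast
  moreover have "x + y + y' + x + y = y'"
    using add_cancel_char2[of x "y + (y + y')"] add_cancel_char2[of y y']
    by (simp add: algebra_simps)
  ultimately show False using y'(1) by simp
qed

text \<open>Beyond the range of \<open>ex_zero_sum\<close> the group itself and the group without 0
  serve. The omitted size leaves a two-point complement, whose total is nonzero.\<close>

lemma ex_zero_sum_large:
  assumes "3 \<le> m" "m \<le> CARD('a)" "m + 2 \<noteq> CARD('a)"
  shows "\<exists>A::'a set. card A = m \<and> \<Sum>A = 0"
proof -
  consider "m + 3 \<le> CARD('a)" | "m = CARD('a)" | "m + 1 = CARD('a)" using assms by linarith
  then show ?thesis
  proof cases
    case 1
    then show ?thesis using ex_zero_sum assms(1) by blast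
  next
    case 2
    then show ?thesis using sum_UNIV_char2 assms(1) by blast
  next
    case 3
    then show ?thesis using sum_Compl_char2[of "{0}"] assms
      by (intro exI[of _ "- {0}"]) (auto simp: card_Compl_finite)
  qed
qed

section \<open>Values of the two invariants\<close>

lemma C_num_char2:
  assumes "CARD('a) \<le> 2 * h + 2" "h + 2 \<le> CARD('a)"
  shows "C_num TYPE('a) h = h + 2"
proof -
  obtain A :: "'a set" where A: "card A = h + 2"
    using assms(2) by (metis obtain_subset_with_card_n)
  show ?thesis
    unfolding C_num_def
    using sum_notin_restricted_sumset[OF A] card_le_if_restricted_sumset_neq_UNIV[OF _ assms(1)]
    by (intro Max_card_eqI[OF _ A]) auto
qed

lemma Z_num_char2:
  assumes "0 < h" "CARD('a) \<le> 2 * h + 2" "h + 2 \<le> CARD('a)" "h + 4 \<noteq> CARD('a)"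
  shows "Z_num TYPE('a) h = h + 2"
proof -
  obtain A :: "'a set" where A: "card A = h + 2" "\<Sum>A = 0"
    using ex_zero_sum_large[of "h + 2"] assms by auto
  show ?thesis
    unfolding Z_num_def
    using sum_notin_restricted_sumset[OF A(1)] A(2)
      card_le_if_restricted_sumset_neq_UNIV[OF _ assms(2)]
    by (intro Max_card_eqI[OF _ A(1)]) auto
qed

lemma zero_in_restricted_sumset_exceptional:
  fixes A :: "'a set"
  assumes "card A = h + 1" "h + 4 = CARD('a)"
  shows "0 \<in> restricted_sumset h A"
proof -
  have "card (- A) = 3" using assms by (simp add: card_Compl_finite)
  then obtain x y z where xyz: "- A = {x, y, z}" "x \<noteq> y" "y \<noteq> z" "x \<noteq> z"
    by (metis card_3_iff)
  then have "\<Sum>A = x + (y + z)" using sum_Compl_char2[of A] assms by simp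
  \<comment> \<open>Equality with one of the three points would force the other two to
    coincide.\<close>
  moreover have "x + (y + z) \<notin> - A"
  proof -
    have "x + (y + z) \<noteq> x" using xyz(3) by (simp add: add_eq_zero_iff)
    moreover have "y + (x + z) \<noteq> y" using xyz(4) by (simp add: add_eq_zero_iff)
    moreover have "z + (x + y) \<noteq> z" using xyz(2) by (simp add: add_eq_zero_iff)
    ultimately show ?thesis unfolding xyz(1) by (simp add: ac_simps)
  qed
  ultimately have "\<Sum>A \<in> restricted_sumset 1 A" unfolding restricted_sumset_one by simp
  then show ?thesis
    unfolding restricted_sumset_complement[OF assms(1)] by (intro image_eqI) auto
qed

lemma Z_num_exceptional:
  assumes "0 < h" "h + 4 = CARD('a)"
  shows "Z_num TYPE('a) h = h"
proof -
  \<comment> \<open>An h-set has its total as its only h-fold sum, so a nonzero total gives the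
    lower bound.\<close>
  obtain A :: "'a set" where A: "card A = h" "\<Sum>A \<noteq> 0"
    using ex_nonzero_sum[of h] assms by auto
  have upper: "card B \<le> h" if "0 \<notin> restricted_sumset h B" for B :: "'a set"
  proof (rule ccontr)
    assume "\<not> card B \<le> h"
    then have "h + 1 \<le> card B" by simp
    then obtain D where "D \<subseteq> B" "card D = h + 1" by (metis obtain_subset_with_card_n)
    with zero_in_restricted_sumset_exceptional[OF _ assms(2)] restricted_sumset_mono that
    show False by blast
  qed
  have "0 \<notin> restricted_sumset h A" using restricted_sumset_card[of A] A by auto
  then show ?thesis unfolding Z_num_def using A(1) upper by (rule Max_card_eqI)
qed

end

theorem theorem1p3:
  fixes n r h :: nat
  assumes "elementary_abelian_2_group TYPE('a::{ab_group_add,finite})"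
    and "CARD('a) = n" and "n = 2 ^ r"
    and "h > 0"
    and "real n / 2 - 1 \<le> real h" and "real h \<le> real n - 2"
  shows "(int h \<noteq> int n - 4 \<longrightarrow>
            C_num TYPE('a) h = h + 2 \<and> Z_num TYPE('a) h = h + 2) \<and>
         (int h = int n - 4 \<longrightarrow>
            C_num TYPE('a) h = h + 2 \<and> Z_num TYPE('a) h = h)"
proof -
  have char2: "\<And>x::'a. x + x = 0"
    using assms(1) unfolding elementary_abelian_2_group_def by blast
  have n: "CARD('a) \<le> 2 * h + 2" "h + 2 \<le> CARD('a)"
    using assms(2,5,6) by linarith+
  have "int h = int n - 4 \<longleftrightarrow> h + 4 = CARD('a)" using assms(2) by linarith
  then show ?thesis
    using C_num_char2[OF char2 n] Z_num_char2[OF char2 assms(4) n]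
      Z_num_exceptional[OF char2 assms(4)] by blast
qed

end
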